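(* For any integer $\eta \ge 6$ and any positive integer $m$ with $4m \ge (\eta - 2)^2$, there exists a numerical semigroup $S$ with embedding dimension $4$, multiplicity $m$, and $\eta(S) = \eta$.
   Context: A numerical semigroup is a cofinite subset $S \subseteq \mathbb{Z}_{\ge 0}$ containing $0$ and closed under addition, with unique minimal generating set $n_1 < \cdots < n_e$; $e$ is the embedding dimension and $n_1$ the multiplicity. With $\varphi_S:\mathbb{Z}_{\ge 0}^e \to S$, $z \mapsto \sum z_in_i$, a presentation of $S$ is a subset of $\ker\varphi_S = \{(z,z') : \varphi_S(z) = \varphi_S(z')\}$ whose generated congruence is $\ker\varphi_S$; it is minimal if no proper subset is a presentation. All minimal presentations have the same cardinality, denoted $\eta(S)$. *)

theory Defs
  imports Complex_Main "HOL.Hull"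
begin

definition submonoid :: "nat set \<Rightarrow> bool" where
  "submonoid S \<longleftrightarrow> 0 \<in> S \<and> (\<forall>a\<in>S. \<forall>b\<in>S. a + b \<in> S)"

definition numerical_semigroup :: "nat set \<Rightarrow> bool" where
  "numerical_semigroup S \<longleftrightarrow> submonoid S \<and> finite (- S)"

definition minimal_generating_set :: "nat set \<Rightarrow> nat set \<Rightarrow> bool" where
  "minimal_generating_set S A \<longleftrightarrow>
     submonoid hull A = S \<and> (\<forall>B. B \<subset> A \<longrightarrow> submonoid hull B \<noteq> S)"

definition minimal_generators :: "nat set \<Rightarrow> nat set" where
  "minimal_generators S = (THE A. minimal_generating_set S A)"

definition embedding_dimension :: "nat set \<Rightarrow> nat" where
  "embedding_dimension S = card (minimal_generators S)"

definition multiplicity :: "nat set \<Rightarrow> nat" where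
  "multiplicity S = Min (minimal_generators S)"

text \<open>The tuples in $\mathbb{Z}_{\ge 0}^e$ are the functions on the naturals that vanish
  from index \<open>e\<close> on. Indices start at 0, so \<open>generator S i\<close> is $n_{i+1}$.\<close>

definition tuples :: "nat \<Rightarrow> (nat \<Rightarrow> nat) set" where
  "tuples e = {z. \<forall>i\<ge>e. z i = 0}"

definition generator :: "nat set \<Rightarrow> nat \<Rightarrow> nat" where
  "generator S i = sorted_list_of_set (minimal_generators S) ! i"

definition factorization_map :: "nat set \<Rightarrow> (nat \<Rightarrow> nat) \<Rightarrow> nat" where
  "factorization_map S z = (\<Sum>i<embedding_dimension S. z i * generator S i)"

definition factorization_kernel :: "nat set \<Rightarrow> ((nat \<Rightarrow> nat) \<times> (nat \<Rightarrow> nat)) set" where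
  "factorization_kernel S =
     {(z, z'). z \<in> tuples (embedding_dimension S) \<and> z' \<in> tuples (embedding_dimension S) \<and>
        factorization_map S z = factorization_map S z'}"

definition congruence :: "nat \<Rightarrow> ((nat \<Rightarrow> nat) \<times> (nat \<Rightarrow> nat)) set \<Rightarrow> bool" where
  "congruence e R \<longleftrightarrow> equiv (tuples e) R \<and>
     (\<forall>z z' w. (z, z') \<in> R \<longrightarrow> w \<in> tuples e \<longrightarrow> ((\<lambda>i. z i + w i), (\<lambda>i. z' i + w i)) \<in> R)"

definition presentation :: "nat set \<Rightarrow> ((nat \<Rightarrow> nat) \<times> (nat \<Rightarrow> nat)) set \<Rightarrow> bool" where
  "presentation S \<rho> \<longleftrightarrow> \<rho> \<subseteq> factorization_kernel S \<and>
     congruence (embedding_dimension S) hull \<rho> = factorization_kernel S"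

definition minimal_presentation :: "nat set \<Rightarrow> ((nat \<Rightarrow> nat) \<times> (nat \<Rightarrow> nat)) set \<Rightarrow> bool" where
  "minimal_presentation S \<rho> \<longleftrightarrow> presentation S \<rho> \<and> (\<forall>\<sigma>. \<sigma> \<subset> \<rho> \<longrightarrow> \<not> presentation S \<sigma>)"

text \<open>The common cardinality of all minimal presentations. Finiteness is required because
  \<open>card\<close> is 0 on infinite sets.\<close>

definition eta :: "nat set \<Rightarrow> nat" where
  "eta S = (THE k. \<forall>\<rho>. minimal_presentation S \<rho> \<longrightarrow> finite \<rho> \<and> card \<rho> = k)"

end

theory Submission
  imports Defs
begin

text \<open>Let \<open>p = (\<eta> - 2) div 2\<close>, \<open>H = \<eta> - 2 - p\<close> and \<open>d = m - p * H\<close>. The semigroup is generated by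
  \<open>m\<close> and three numbers \<open>a \<equiv> -H\<close>, \<open>b \<equiv> 1\<close>, \<open>c \<equiv> 1 - H\<close> modulo \<open>m\<close>. With variables \<open>x, y, z\<close> for
  \<open>a, b, c\<close> and \<open>w\<close> for \<open>m\<close>, they satisfy
  \<open>x y = z w\<^sup>2\<close>, \<open>x\<^sup>p\<^sup>-\<^sup>v z\<^sup>v = y\<^sup>d\<^sup>+\<^sup>v w\<^sup>\<dots>\<close> for \<open>0 \<le> v < p\<close>, \<open>y\<^sup>H\<^sup>-\<^sup>u z\<^sup>u = x\<^sup>u\<^sup>-\<^sup>1 w\<^sup>\<dots>\<close> for
  \<open>1 \<le> u \<le> H\<close>, and \<open>y\<^sup>p\<^sup>+\<^sup>d = z\<^sup>p w\<close>, where every exponent of \<open>w\<close> is positive: \<open>p + H + 2 = \<eta>\<close>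
  relations. The monomials in \<open>x, y, z\<close> divisible by none of the \<open>\<eta>\<close> left-hand sides have pairwise
  distinct residues modulo \<open>m\<close>: \<open>x\<^sup>i y\<^sup>j z\<^sup>k\<close> has the residue of \<open>(j + k) - H (i + k)\<close>, and these
  integers are distinct and lie in a window of length \<open>m\<close>. Hence these monomials are the only
  factorizations of their values. It follows that no left-hand side shares an atom with
  another factorization of its value, while all other factorizations of that value are connected
  to one another. As the values of the left-hand sides are distinct, a minimal
  presentation has exactly one relation for each of them.\<close>

subsection \<open>Isolated factorizations and minimal presentations\<close>

lemma factorization_map_add:
  "factorization_map S (\<lambda>i. z i + w i) = factorization_map S z + factorization_map S w"
  by (simp add: factorization_map_def sum.distrib distrib_right)

lemma add_in_tuples: "z \<in> tuples e \<Longrightarrow> w \<in> tuples e \<Longrightarrow> (\<lambda>i. z i + w i) \<in> tuples e"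
  by (simp add: tuples_def)

lemma congruence_factorization_kernel:
  "congruence (embedding_dimension S) (factorization_kernel S)"
  unfolding congruence_def
proof (intro conjI allI impI)
  show "equiv (tuples (embedding_dimension S)) (factorization_kernel S)"
    by (rule equivI) (auto simp: factorization_kernel_def refl_on_def sym_def trans_def)
qed (auto simp: factorization_kernel_def factorization_map_add add_in_tuples)

lemma congruence_hull_subset_kernel:
  "\<rho> \<subseteq> factorization_kernel S \<Longrightarrow>
    congruence (embedding_dimension S) hull \<rho> \<subseteq> factorization_kernel S"
  by (metis hull_minimal congruence_factorization_kernel)

definition uniquely_factored :: "nat set \<Rightarrow> (nat \<Rightarrow> nat) \<Rightarrow> bool" where
  "uniquely_factored S z \<longleftrightarrow> (\<forall>z'. (z, z') \<in> factorization_kernel S \<longrightarrow> z' = z)"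

text \<open>Trivial pairs are excluded, since they add nothing to a congruence. Either orientation
  counts, since congruences are symmetric.\<close>

definition links :: "'a \<Rightarrow> 'a \<times> 'a \<Rightarrow> bool" where
  "links g \<pi> \<longleftrightarrow> fst \<pi> = g \<and> snd \<pi> \<noteq> g \<or> snd \<pi> = g \<and> fst \<pi> \<noteq> g"

text \<open>The members of \<open>G\<close> are factorizations that share no atom with any other factorization of the
  same element; apart from them, every element has at most one class of factorizations connected
  by shared atoms.\<close>

locale isolated_factorizations =
  fixes S :: "nat set" and G :: "(nat \<Rightarrow> nat) set"
  assumes dim_pos: "0 < embedding_dimension S"
    and generator_pos: "i < embedding_dimension S \<Longrightarrow> 0 < generator S i"
    and finite_G: "finite G"
    and G_tuples: "G \<subseteq> tuples (embedding_dimension S)"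
    and G_alternative: "g \<in> G \<Longrightarrow> \<exists>r. (g, r) \<in> factorization_kernel S \<and> 0 < r 0"
    and G_no_zeroth: "g \<in> G \<Longrightarrow> g 0 = 0"
    and G_divisor: "\<lbrakk>z \<in> tuples (embedding_dimension S); w \<in> tuples (embedding_dimension S);
        (\<lambda>i. z i + w i) \<in> G; w \<noteq> (\<lambda>i. 0)\<rbrakk> \<Longrightarrow> uniquely_factored S z"
    and G_inj: "inj_on (factorization_map S) G"
    and G_cover: "\<lbrakk>z \<in> tuples (embedding_dimension S); z 0 = 0; \<not> uniquely_factored S z\<rbrakk> \<Longrightarrow>
        \<exists>g\<in>G. \<exists>w\<in>tuples (embedding_dimension S). z = (\<lambda>i. g i + w i)"
begin

abbreviation "e \<equiv> embedding_dimension S"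
abbreviation "\<phi> \<equiv> factorization_map S"
abbreviation "K \<equiv> factorization_kernel S"

lemma kernelD:
  assumes "(z, z') \<in> K" shows "z \<in> tuples e" "z' \<in> tuples e" "\<phi> z = \<phi> z'"
  using assms by (auto simp: factorization_kernel_def)

lemma map_pos:
  assumes "w \<in> tuples e" "w \<noteq> (\<lambda>i. 0)" shows "0 < \<phi> w"
proof -
  obtain i where i: "w i \<noteq> 0" using assms(2) by auto
  with assms(1) have "i < e" by (auto simp: tuples_def intro: ccontr[of "i < embedding_dimension S"])
  with i generator_pos have "0 < w i * generator S i" by simp
  also have "\<dots> \<le> \<phi> w" unfolding factorization_map_def
    by (rule member_le_sum) (use \<open>i < e\<close> in auto)
  finally show ?thesis .
qed

text \<open>The kernel pairs that do not relate \<open>g\<close> to anything else form a congruence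
  \<open>Q\<close>. If no pair of \<open>\<rho>\<close> links \<open>g\<close>, then
  \<open>Q\<close> contains \<open>\<rho>\<close> and hence the whole kernel, although
  \<open>g\<close> has an alternative factorization.\<close>

lemma presentation_links:
  assumes "presentation S \<rho>" "g \<in> G"
  shows "\<exists>\<pi>\<in>\<rho>. links g \<pi>"
proof (rule ccontr)
  assume none: "\<not> ?thesis"
  define Q where "Q = {(z, z') \<in> K. z = g \<longleftrightarrow> z' = g}"
  \<comment> \<open>A nontrivial translate that hits \<open>g\<close> starts at a proper divisor of
    \<open>g\<close>. Such a divisor is uniquely factored, so it is related only to itself.\<close>
  have step: "(\<lambda>i. z' i + w i) = g"
    if Kz: "(z, z') \<in> K" and z: "z = g \<longleftrightarrow> z' = g" and w: "w \<in> tuples e"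
      and eq: "(\<lambda>i. z i + w i) = g" for z z' w
  proof (cases "w = (\<lambda>i. 0)")
    case True
    then show ?thesis using z eq by auto
  next
    case False
    then have "uniquely_factored S z"
      using G_divisor[of z w] kernelD[OF Kz] w eq assms(2) by simp
    then have "z' = z" using Kz by (auto simp: uniquely_factored_def)
    then show ?thesis using eq by simp
  qed
  have symK: "sym K" and equivK: "equiv (tuples e) K"
    using congruence_factorization_kernel[of S] by (auto simp: congruence_def equiv_def)
  have "congruence e Q"
    unfolding congruence_def
  proof (intro conjI allI impI)
    show "equiv (tuples e) Q"
      by (rule equivI) (auto simp: Q_def factorization_kernel_def refl_on_def sym_def trans_def)
    fix z z' w assume Q: "(z, z') \<in> Q" and w: "w \<in> tuples e"
    then have *: "((\<lambda>i. z i + w i), (\<lambda>i. z' i + w i)) \<in> K"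
      using congruence_factorization_kernel[of S] by (auto simp: congruence_def Q_def)
    have "(z', z) \<in> K" using Q symK by (auto simp: Q_def sym_def)
    then show "((\<lambda>i. z i + w i), (\<lambda>i. z' i + w i)) \<in> Q"
      using step[of z z' w] step[of z' z w] w Q * by (auto simp: Q_def)
  qed
  moreover have "\<rho> \<subseteq> Q"
    using assms(1) none by (auto simp: Q_def presentation_def links_def)
  ultimately have "K \<subseteq> Q"
    using hull_minimal[of \<rho> Q "congruence e"] assms(1) by (simp add: presentation_def)
  moreover obtain r where "(g, r) \<in> K" "0 < r 0" using G_alternative[OF assms(2)] by auto
  ultimately have "r = g" by (auto simp: Q_def)
  with \<open>0 < r 0\<close> G_no_zeroth[OF assms(2)] show False by simp
qed

text \<open>Strong induction on the common value \<open>n\<close>. Every \<open>z\<close> of value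
  \<open>n\<close> that is not uniquely factored is related in \<open>C\<close> to some
  factorization containing atom 0, and all factorizations containing atom 0 are related to one
  another.\<close>

lemma linked_congruence_contains_kernel:
  assumes \<rho>: "\<rho> \<subseteq> K" "\<And>g. g \<in> G \<Longrightarrow> \<exists>\<pi>\<in>\<rho>. links g \<pi>"
    and C: "congruence e C" "\<rho> \<subseteq> C"
  shows "K \<subseteq> C"
proof -
  have eqC: "refl_on (tuples e) C" "sym C" "trans C"
    and addC: "\<And>z z' w. (z, z') \<in> C \<Longrightarrow> w \<in> tuples e \<Longrightarrow>
      ((\<lambda>i. z i + w i), (\<lambda>i. z' i + w i)) \<in> C"
    using C(1) by (auto simp: congruence_def equiv_def)
  have "\<forall>z z'. (z, z') \<in> K \<longrightarrow> \<phi> z = n \<longrightarrow> (z, z') \<in> C" for n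
  proof (induction n rule: less_induct)
    case (less n)
    have IH: "(z, z') \<in> C" if "(z, z') \<in> K" "\<phi> z < n" for z z'
      using less that by blast
    \<comment> \<open>One copy of atom 0 is cancelled on both sides, which lowers the value; the
      induction hypothesis is then translated back.\<close>
    have zeroth: "(z, z') \<in> C" if Kz: "(z, z') \<in> K" and n: "\<phi> z = n" and pos: "0 < z 0" "0 < z' 0"
      for z z'
    proof -
      define d :: "nat \<Rightarrow> nat" where "d = (\<lambda>i. if i = 0 then 1 else 0)"
      define y y' where "y = (\<lambda>i. z i - d i)" and "y' = (\<lambda>i. z' i - d i)"
      have d: "d \<in> tuples e" "d \<noteq> (\<lambda>i. 0)"
        using dim_pos by (auto simp: d_def tuples_def fun_eq_iff)
      have z: "z = (\<lambda>i. y i + d i)" "z' = (\<lambda>i. y' i + d i)"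
        using pos by (auto simp: y_def y'_def d_def)
      have y: "y \<in> tuples e" "y' \<in> tuples e"
        using kernelD[OF Kz] by (auto simp: y_def y'_def tuples_def)
      have "\<phi> z = \<phi> y + \<phi> d" "\<phi> z' = \<phi> y' + \<phi> d"
        by (simp_all add: z factorization_map_add)
      then have "(y, y') \<in> K" "\<phi> y < n"
        using y kernelD[OF Kz] n map_pos[OF d] by (auto simp: factorization_kernel_def)
      then show ?thesis unfolding z using IH addC d by blast
    qed
    \<comment> \<open>For a proper multiple of \<open>g\<close>, the value of \<open>g\<close> is
      below \<open>n\<close>, so \<open>g\<close> can be exchanged for its alternative by the
      induction hypothesis.\<close>
    have multiple: "\<exists>r. (z, r) \<in> C \<and> (z, r) \<in> K \<and> 0 < r 0"
      if z: "\<phi> z = n" "z = (\<lambda>i. g i + w i)" "g \<in> G" "w \<in> tuples e" "w \<noteq> (\<lambda>i. 0)" for z g w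
    proof -
      obtain r where r: "(g, r) \<in> K" "0 < r 0" using G_alternative[OF z(3)] by auto
      have "\<phi> g < n" using z map_pos[OF z(4,5)] by (auto simp: factorization_map_add)
      then have "(g, r) \<in> C" using IH r by blast
      then have "(z, \<lambda>i. r i + w i) \<in> C" using addC z by auto
      moreover have "(z, \<lambda>i. r i + w i) \<in> K"
        using congruence_factorization_kernel[of S] r z by (auto simp: congruence_def)
      ultimately show ?thesis using r(2) by (intro exI[of _ "\<lambda>i. r i + w i"]) auto
    qed
    have connected: "\<exists>r. (z, r) \<in> C \<and> (z, r) \<in> K \<and> 0 < r 0"
      if z: "z \<in> tuples e" "\<phi> z = n" "\<not> uniquely_factored S z" for z
    proof (cases "0 < z 0")
      case True
      then show ?thesis using z eqC(1) by (auto simp: refl_on_def factorization_kernel_def)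
    next
      case False
      then obtain g w where g: "g \<in> G" "w \<in> tuples e" "z = (\<lambda>i. g i + w i)"
        using G_cover z by blast
      show ?thesis
      proof (cases "w = (\<lambda>i. 0)")
        case False
        then show ?thesis using multiple g z by blast
      next
        case True
        then have "z = g" using g by simp
        \<comment> \<open>No smaller value helps with \<open>g\<close> itself, so the link in
          \<open>\<rho>\<close> is used. Its other end \<open>z'\<close> may lack atom 0 too, but it
          is then a proper multiple of a member of \<open>G\<close>, because \<open>G\<close> has
          only one member of this value.\<close>
        obtain \<pi> where "\<pi> \<in> \<rho>" "links g \<pi>" using \<rho>(2) g by blast
        then obtain z' where z': "z' \<noteq> g" "(g, z') \<in> \<rho> \<or> (z', g) \<in> \<rho>"
          by (cases \<pi>) (auto simp: links_def)
        have gC: "(g, z') \<in> C" using z'(2) C(2) eqC(2) by (auto simp: sym_def)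
        have gK: "(g, z') \<in> K" using z'(2) \<rho>(1) by (auto simp: factorization_kernel_def)
        have Kg: "(z', g) \<in> K" using gK by (auto simp: factorization_kernel_def)
        have val: "\<phi> z' = n" using kernelD[OF gK] z \<open>z = g\<close> by simp
        have "\<exists>r. (z', r) \<in> C \<and> (z', r) \<in> K \<and> 0 < r 0"
        proof (cases "0 < z' 0")
          case True
          then show ?thesis using kernelD[OF gK] eqC(1)
            by (auto simp: refl_on_def factorization_kernel_def)
        next
          case False
          have "\<not> uniquely_factored S z'"
            using Kg z'(1) by (auto simp: uniquely_factored_def)
          then obtain g' w' where g': "g' \<in> G" "w' \<in> tuples e" "z' = (\<lambda>i. g' i + w' i)"
            using G_cover False kernelD[OF gK] by blast
          have "w' \<noteq> (\<lambda>i. 0)"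
          proof
            assume "w' = (\<lambda>i. 0)"
            then have "z' = g'" using g' by simp
            then show False
              using inj_onD[OF G_inj, of g' g] g' g z'(1) val z(2) \<open>z = g\<close> by auto
          qed
          then show ?thesis using multiple g' val by blast
        qed
        then show ?thesis
          using gC gK eqC(3) \<open>z = g\<close> by (auto simp: factorization_kernel_def dest: transD)
      qed
    qed
    show ?case
    proof (intro allI impI)
      fix z z' assume K: "(z, z') \<in> K" and n: "\<phi> z = n"
      note D = kernelD[OF K]
      show "(z, z') \<in> C"
      proof (cases "z' = z")
        case True
        then show ?thesis using D eqC(1) by (auto simp: refl_on_def)
      next
        case False
        have K': "(z', z) \<in> K" using K by (auto simp: factorization_kernel_def)
        have "\<not> uniquely_factored S z" "\<not> uniquely_factored S z'"
          using False K K' by (auto simp: uniquely_factored_def)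
        then obtain r r' where r: "(z, r) \<in> C" "(z, r) \<in> K" "0 < r 0"
          and r': "(z', r') \<in> C" "(z', r') \<in> K" "0 < r' 0"
          using connected[of z] connected[of z'] D n by auto
        have "(r, r') \<in> K" "\<phi> r = n"
          using r r' D n by (auto simp: factorization_kernel_def)
        then have "(r, r') \<in> C" using zeroth r r' by blast
        then show ?thesis using r(1) r'(1) eqC(2,3) by (meson symD transD)
      qed
    qed
  qed
  then show ?thesis by auto
qed

lemma presentation_iff_links:
  assumes "\<rho> \<subseteq> K"
  shows "presentation S \<rho> \<longleftrightarrow> (\<forall>g\<in>G. \<exists>\<pi>\<in>\<rho>. links g \<pi>)"
proof
  assume "\<forall>g\<in>G. \<exists>\<pi>\<in>\<rho>. links g \<pi>"
  then have "K \<subseteq> congruence e hull \<rho>"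
    using linked_congruence_contains_kernel[OF assms] unfolding hull_def by blast
  then show "presentation S \<rho>"
    using congruence_hull_subset_kernel[OF assms] assms by (auto simp: presentation_def)
qed (use presentation_links in blast)

text \<open>Both ends of a relation have the same value, and \<open>G\<close> has at most one member
  of each value. Hence one relation cannot serve two members of \<open>G\<close>.\<close>

lemma links_unique:
  assumes "\<pi> \<in> K" "g \<in> G" "g' \<in> G" "links g \<pi>" "links g' \<pi>"
  shows "g = g'"
  using assms inj_onD[OF G_inj, of g g'] by (cases \<pi>) (auto simp: links_def factorization_kernel_def)

text \<open>Choosing one link for each member of \<open>G\<close> already gives a presentation
  inside \<open>\<rho>\<close>, so by minimality it is all of \<open>\<rho>\<close>.\<close>

lemma minimal_presentation_card:
  assumes "minimal_presentation S \<rho>"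
  shows "finite \<rho> \<and> card \<rho> = card G"
proof -
  have \<rho>: "presentation S \<rho>" "\<rho> \<subseteq> K"
    using assms by (auto simp: minimal_presentation_def presentation_def)
  obtain f where f: "\<And>g. g \<in> G \<Longrightarrow> f g \<in> \<rho> \<and> links g (f g)"
    using presentation_links[OF \<rho>(1)] by metis
  then have "f ` G \<subseteq> \<rho>" by auto
  moreover have "presentation S (f ` G)"
    using presentation_iff_links[of "f ` G"] \<open>f ` G \<subseteq> \<rho>\<close> \<rho>(2) f by blast
  ultimately have "f ` G = \<rho>"
    using assms by (auto simp: minimal_presentation_def)
  moreover have "inj_on f G"
  proof (rule inj_onI)
    fix g g' assume "g \<in> G" "g' \<in> G" "f g = f g'"
    then show "g = g'"
      using links_unique[of "f g" g g'] f \<rho>(2) by (metis subsetD)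
  qed
  ultimately show ?thesis using finite_G card_image by blast
qed

text \<open>Without existence, every \<open>k\<close> would satisfy the condition in
  \<open>eta\<close> vacuously and the description would not be unique.\<close>

lemma minimal_presentation_exists: "\<exists>\<rho>. minimal_presentation S \<rho>"
proof -
  obtain r where r: "\<And>g. g \<in> G \<Longrightarrow> (g, r g) \<in> K \<and> 0 < r g 0"
    using G_alternative by metis
  define f where "f g = (g, r g)" for g
  have fK: "f ` G \<subseteq> K" using r by (auto simp: f_def)
  have links: "links g (f g)" if "g \<in> G" for g
    using r[OF that] G_no_zeroth[OF that] by (auto simp: links_def f_def)
  have "\<not> presentation S \<sigma>" if "\<sigma> \<subset> f ` G" for \<sigma>
  proof
    assume \<sigma>: "presentation S \<sigma>"
    obtain g where g: "g \<in> G" "f g \<notin> \<sigma>" using \<open>\<sigma> \<subset> f ` G\<close> by blast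
    obtain \<pi> where \<pi>: "\<pi> \<in> \<sigma>" "links g \<pi>" using presentation_links[OF \<sigma> g(1)] by auto
    then obtain g' where "g' \<in> G" "\<pi> = f g'" using \<open>\<sigma> \<subset> f ` G\<close> by auto
    then have "g = g'" using links_unique[of \<pi> g g'] links g \<pi> fK by auto
    then show False using g \<pi> \<open>\<pi> = f g'\<close> by simp
  qed
  then have "minimal_presentation S (f ` G)"
    using presentation_iff_links[OF fK] links by (auto simp: minimal_presentation_def)
  then show ?thesis ..
qed

lemma eta_eq_card: "eta S = card G"
  unfolding eta_def
proof (rule the_equality)
  fix k assume "\<forall>\<rho>. minimal_presentation S \<rho> \<longrightarrow> finite \<rho> \<and> card \<rho> = k"
  then show "k = card G"
    using minimal_presentation_exists minimal_presentation_card by metis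
qed (use minimal_presentation_card in blast)

end

section \<open>Minimal generators of a submonoid\<close>

lemma submonoid_mult: "submonoid M \<Longrightarrow> x \<in> M \<Longrightarrow> n * x \<in> M"
  by (induction n) (auto simp: submonoid_def)

lemma submonoid_hull: "submonoid (submonoid hull A)"
  by (rule hull_in) (auto simp: submonoid_def)

text \<open>Removing an irreducible element from \<open>S\<close> leaves a submonoid, so every
  generating set contains it. Hence \<open>A\<close> is the least generating set.\<close>

lemma minimal_generators_eq:
  assumes gen: "submonoid hull A = S"
    and irreducible: "\<And>g. g \<in> A \<Longrightarrow> g \<noteq> 0"
      "\<And>g s t. g \<in> A \<Longrightarrow> s \<in> S \<Longrightarrow> t \<in> S \<Longrightarrow> g = s + t \<Longrightarrow> s = 0 \<or> t = 0"
  shows "minimal_generators S = A"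
proof -
  have S: "submonoid S" using submonoid_hull gen by blast
  have least: "A \<subseteq> B" if B: "submonoid hull B = S" for B
  proof
    fix g assume g: "g \<in> A"
    show "g \<in> B"
    proof (rule ccontr)
      assume "g \<notin> B"
      then have "B \<subseteq> S - {g}" using hull_subset[of B submonoid] B by blast
      moreover have "submonoid (S - {g})"
        unfolding submonoid_def
      proof (intro conjI ballI)
        show "0 \<in> S - {g}" using S irreducible(1)[OF g] by (auto simp: submonoid_def)
        fix s t assume "s \<in> S - {g}" "t \<in> S - {g}"
        then show "s + t \<in> S - {g}"
          using S irreducible(2)[OF g, of s t] by (auto simp: submonoid_def)
      qed
      ultimately have "S \<subseteq> S - {g}" using hull_minimal[of B "S - {g}" submonoid] B by simp
      moreover have "g \<in> S" using hull_subset[of A submonoid] gen g by blast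
      ultimately show False by blast
    qed
  qed
  show ?thesis unfolding minimal_generators_def
  proof (rule the_equality)
    show "minimal_generating_set S A"
      using gen least unfolding minimal_generating_set_def by blast
    show "B = A" if "minimal_generating_set S B" for B
      using that gen least unfolding minimal_generating_set_def by blast
  qed
qed

subsection \<open>Arithmetic of the staircase semigroup\<close>

text \<open>A number \<open>val i j k = i * a + j * b + k * c\<close> stands for the monomial \<open>x\<^sup>i y\<^sup>j z\<^sup>k\<close>, and
  \<open>corners\<close> are the exponents of the left-hand sides. The coefficients of \<open>m\<close> in \<open>a\<close>, \<open>b\<close>, \<open>c\<close>
  are chosen such that all exponents of \<open>w\<close> become positive. The subtractions in
  \<open>a\<close> and \<open>c\<close> do not truncate.\<close>

locale staircase =
  fixes p H d :: nat
  assumes p: "2 \<le> p" and H: "p \<le> H" "H \<le> p + 1" "H \<le> p + d"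
begin

definition m :: nat where "m = p * H + d"
definition a :: nat where "a = m * (d + 2) - H"
definition b :: nat where "b = m * p + 1"
definition c :: nat where "c = m * (p + d) + 1 - H"

definition val :: "nat \<Rightarrow> nat \<Rightarrow> nat \<Rightarrow> nat" where
  "val i j k = i * a + j * b + k * c"

definition corners :: "(nat \<times> nat \<times> nat) set" where
  "corners = {(1, 1, 0), (0, p + d, 0)} \<union> (\<lambda>v. (p - v, 0, v)) ` {..<p} \<union>
     (\<lambda>u. (0, H - u, u)) ` {1..H}"

definition standard :: "nat \<Rightarrow> nat \<Rightarrow> nat \<Rightarrow> bool" where
  "standard i j k \<longleftrightarrow> (\<forall>(x, y, z)\<in>corners. \<not> (x \<le> i \<and> y \<le> j \<and> z \<le> k))"

lemma H_less_m: "H < m"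
proof -
  have "2 * H \<le> p * H" using p by (intro mult_right_mono) auto
  then show ?thesis using p H(1) unfolding m_def by linarith
qed

text \<open>Over the integers the generators are polynomials in \<open>p\<close>, \<open>H\<close>,
  \<open>d\<close>, so the relations become ring identities.\<close>

lemma int_m: "int m = int p * int H + int d" by (simp add: m_def)

lemma int_a: "int a = int m * (int d + 2) - int H"
proof -
  have "m * 1 \<le> m * (d + 2)" by (intro mult_left_mono) auto
  then have "H \<le> m * (d + 2)" using H_less_m by linarith
  then show ?thesis by (simp add: a_def of_nat_diff algebra_simps)
qed

lemma int_b: "int b = int m * int p + 1" by (simp add: b_def)

lemma int_c: "int c = int m * (int p + int d) + 1 - int H"
proof -
  have "m * 1 \<le> m * (p + d)" using p by (intro mult_left_mono) auto
  then have "H \<le> m * (p + d)" using H_less_m by linarith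
  then show ?thesis by (simp add: c_def of_nat_diff algebra_simps)
qed

lemmas int_generators = int_a int_b int_c

lemma m_less: "m < a" "m < b" "m < c"
proof -
  have "int m < int a"
  proof -
    have "int m * 2 \<le> int m * (int d + 2)" by (intro mult_left_mono) auto
    then show ?thesis using H_less_m unfolding int_a by linarith
  qed
  then show "m < a" by simp
  have "int m * 2 \<le> int m * int p" using p by (intro mult_left_mono) auto
  then have "int m < int b" unfolding int_b by linarith
  then show "m < b" by simp
  have "int m * 2 \<le> int m * (int p + int d)" using p by (intro mult_left_mono) auto
  then have "int m < int c" using H_less_m unfolding int_c by linarith
  then show "m < c" by simp
qed

lemma m_pos: "0 < m" using H_less_m by simp

section \<open>The relations among the generators\<close>

lemma relation_xy: "a + b = c + 2 * m"
proof -
  have "int (a + b) = int (c + 2 * m)" by (simp add: int_generators algebra_simps)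
  then show ?thesis by (simp only: of_nat_eq_iff)
qed

lemma relation_xz:
  assumes "v < p" shows "(p - v) * a + v * c = (d + v) * b + (2 * (p - v) - 1) * m"
proof -
  \<comment> \<open>With \<open>w = p - v - 1\<close> the coefficient \<open>2 * (p - v) - 1\<close>
    becomes \<open>2 * w + 1\<close>, free of subtraction.\<close>
  obtain w where w: "p = v + w + 1" using assms less_imp_Suc_add by auto
  then have v: "int v = int p - int w - 1" by simp
  have "int ((w + 1) * a + v * c) = int ((d + v) * b + (2 * w + 1) * m)"
    by (simp add: int_generators int_m v algebra_simps)
  then show ?thesis using w by (simp only: of_nat_eq_iff) simp
qed

text \<open>The coefficient of \<open>m\<close> is split over both sides to avoid a truncated
  difference; \<open>relation_yz'\<close> recombines it.\<close>

lemma relation_yz: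
  assumes "1 \<le> u" "u \<le> H"
  shows "(H - u) * b + u * c + 2 * u * m = (u - 1) * a + (H * p + d + 2) * m"
proof -
  obtain w where w: "H = u + w" using assms(2) le_Suc_ex by auto
  obtain t where t: "u = Suc t" using assms(1) by (cases u) auto
  have v: "int w = int H - int u" "int t = int u - 1" using w t by simp_all
  have "int (w * b + u * c + 2 * u * m) = int (t * a + (H * p + d + 2) * m)"
    by (simp add: int_generators int_m v algebra_simps)
  then show ?thesis using w t by (simp only: of_nat_eq_iff) simp
qed

text \<open>This makes the coefficient of \<open>m\<close> in \<open>relation_yz'\<close> at least
  2.\<close>

lemma yz_weight:
  assumes "u \<le> H" shows "2 * u \<le> H * p + d"
proof -
  have "H * 2 \<le> H * p" using p by (intro mult_left_mono) auto
  then show ?thesis using assms by linarith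
qed

lemma relation_yz':
  assumes "1 \<le> u" "u \<le> H"
  shows "(H - u) * b + u * c = (u - 1) * a + (H * p + d + 2 - 2 * u) * m"
proof -
  obtain t where "H * p + d + 2 = 2 * u + t"
    using yz_weight[OF assms(2)] by (metis le_Suc_ex trans_le_add1)
  then show ?thesis using relation_yz[OF assms] by (simp add: algebra_simps)
qed

lemma relation_y: "(p + d) * b = p * c + m"
proof -
  have "int ((p + d) * b) = int (p * c + m)"
    by (simp add: int_generators int_m algebra_simps)
  then show ?thesis by (simp only: of_nat_eq_iff)
qed

lemma corners_cases:
  assumes "(i, j, k) \<in> corners"
  obtains (xy) "i = 1" "j = 1" "k = 0"
    | (y) "i = 0" "j = p + d" "k = 0"
    | (xz) v where "v < p" "i = p - v" "j = 0" "k = v"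
    | (yz) u where "1 \<le> u" "u \<le> H" "i = 0" "j = H - u" "k = u"
  using assms by (auto simp: corners_def)

lemma corner_reducible:
  assumes "(i, j, k) \<in> corners"
  shows "\<exists>n i' j' k'. 0 < n \<and> val i j k = n * m + val i' j' k'"
  using assms
proof (cases rule: corners_cases)
  case xy
  then have "val i j k = 2 * m + val 0 0 1" using relation_xy by (simp add: val_def)
  then show ?thesis by (metis zero_less_numeral)
next
  case y
  then have "val i j k = 1 * m + val 0 0 p" using relation_y by (simp add: val_def)
  then show ?thesis by (metis zero_less_one)
next
  case (xz v)
  then have "val i j k = (2 * (p - v) - 1) * m + val 0 (d + v) 0" "0 < 2 * (p - v) - 1"
    using relation_xz[of v] by (auto simp: val_def)
  then show ?thesis by metis
next
  case (yz u)
  then have "val i j k = (H * p + d + 2 - 2 * u) * m + val (u - 1) 0 0" "0 < H * p + d + 2 - 2 * u"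
    using relation_yz'[of u] yz_weight[of u] by (auto simp: val_def)
  then show ?thesis by metis
qed

section \<open>Reduction to standard monomials\<close>

lemma nonstandard_reducible:
  assumes "\<not> standard i j k"
  shows "\<exists>n i' j' k'. 0 < n \<and> val i j k = n * m + val i' j' k'"
proof -
  obtain x y z where x: "(x, y, z) \<in> corners" "x \<le> i" "y \<le> j" "z \<le> k"
    using assms by (auto simp: standard_def)
  obtain i0 j0 k0 where 0: "i = x + i0" "j = y + j0" "k = z + k0"
    using x(2-4) by (meson le_Suc_ex)
  obtain n i' j' k' where n: "0 < n" "val x y z = n * m + val i' j' k'"
    using corner_reducible[OF x(1)] by auto
  have "val i j k = n * m + val (i' + i0) (j' + j0) (k' + k0)"
    using n(2) by (simp add: 0 val_def algebra_simps)
  then show ?thesis using n(1) by blast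
qed

text \<open>Each replacement of a corner pulls out a positive multiple of \<open>m\<close>, so the
  value of the remaining monomial drops and the rewriting ends. The bound on \<open>n'\<close>
  records that the exponent of \<open>w\<close> never decreases.\<close>

lemma normal_form:
  "\<exists>n' i' j' k'. n \<le> n' \<and> standard i' j' k' \<and> n * m + val i j k = n' * m + val i' j' k'"
proof (induction "val i j k" arbitrary: n i j k rule: less_induct)
  case less
  show ?case
  proof (cases "standard i j k")
    case False
    then obtain l i' j' k' where l: "0 < l" "val i j k = l * m + val i' j' k'"
      using nonstandard_reducible by blast
    then have "val i' j' k' < val i j k" using m_pos by simp
    then obtain n' i'' j'' k'' where "n + l \<le> n'" "standard i'' j'' k''"
      "(n + l) * m + val i' j' k' = n' * m + val i'' j'' k''"
      using less[of i' j' k' "n + l"] by blast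
    then show ?thesis using l(2)
      by (intro exI[of _ n'] exI[of _ i''] exI[of _ j''] exI[of _ k'']) (simp add: algebra_simps)
  qed auto
qed

section \<open>Uniqueness of standard factorizations\<close>

text \<open>In the coordinates \<open>(i + k, j + k)\<close> the standard monomials tile the plane.\<close>

definition residue :: "nat \<Rightarrow> nat \<Rightarrow> nat \<Rightarrow> int" where
  "residue i j k = int (j + k) - int H * int (i + k)"

lemma val_residue:
  "int (val i j k) = int m * (int i * (int d + 2) + int j * int p + int k * (int p + int d)) +
    residue i j k"
  by (simp add: val_def residue_def int_generators algebra_simps)

lemma standardD:
  assumes "standard i j k"
  shows "i = 0 \<or> j = 0" "j < p + d" "k < H" "v < p \<Longrightarrow> v \<le> k \<Longrightarrow> i + v < p"
    "1 \<le> u \<Longrightarrow> u \<le> H \<Longrightarrow> u \<le> k \<Longrightarrow> j + u < H"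
proof -
  have s: "\<not> (x \<le> i \<and> y \<le> j \<and> z \<le> k)" if "(x, y, z) \<in> corners" for x y z
    using assms that unfolding standard_def by blast
  show "i = 0 \<or> j = 0" using s[of 1 1 0] by (auto simp: corners_def)
  show "j < p + d" using s[of 0 "p + d" 0] by (auto simp: corners_def)
  show "v < p \<Longrightarrow> v \<le> k \<Longrightarrow> i + v < p" using s[of "p - v" 0 v] by (auto simp: corners_def)
  show *: "1 \<le> u \<Longrightarrow> u \<le> H \<Longrightarrow> u \<le> k \<Longrightarrow> j + u < H" for u
    using s[of 0 "H - u" u] by (auto simp: corners_def)
  show "k < H"
  proof (rule ccontr)
    assume "\<not> k < H"
    then show False using *[of H] p H(1) by simp
  qed
qed

text \<open>The corners with \<open>v = k\<close> and \<open>u = k\<close> bound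
  \<open>i + k\<close> and \<open>j + k\<close>. If \<open>k \<ge> p\<close>, then
  \<open>k < H \<le> p + 1\<close> leaves only \<open>k = p\<close>, and the corners with
  \<open>v = p - 1\<close> and \<open>u = p\<close> force \<open>i = j = 0\<close>.\<close>

lemma standard_shape:
  assumes "standard i j k"
  obtains (column) "i = 0" "k = 0" "j < p + d"
    | (box) "i + k < p" "j + k < H"
    | (tip) "i = 0" "j = 0" "k = p" "H = p + 1"
proof (cases "k < p")
  case True
  then have "i + k < p" using standardD(4)[OF assms, of k] by simp
  then show ?thesis
    using standardD(1,2,3)[OF assms] standardD(5)[OF assms, of k] that(1,2)
    by (cases "k = 0"; cases "i = 0") auto
next
  case False
  then have "k = p" "H = p + 1" using standardD(3)[OF assms] H by auto
  moreover have "p - 1 < p" "p - 1 \<le> k" using False p by auto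
  from standardD(4)[OF assms this] have "i = 0" by simp
  moreover have "j = 0" using standardD(5)[OF assms, of p] False H p \<open>H = p + 1\<close> by auto
  ultimately show ?thesis using that by simp
qed

text \<open>The window has length \<open>m\<close> and is sharp: \<open>y^(p+d-1)\<close> attains
  the maximum, and the minimum is attained by \<open>x^(p-1)\<close> if \<open>H = p\<close> and by
  \<open>z^p\<close> if \<open>H = p + 1\<close>.\<close>

lemma residue_window:
  assumes "standard i j k"
  shows "int p + int d - int m \<le> residue i j k" "residue i j k < int p + int d"
proof -
  have "int p + int d - int m \<le> residue i j k \<and> residue i j k < int p + int d"
    using assms
  proof (cases rule: standard_shape)
    case column
    have "int p * 1 \<le> int p * int H" using p H by (intro mult_left_mono) auto
    then show ?thesis using column unfolding residue_def int_m by simp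
  next
    case box
    have "int H * int (i + k) \<le> int H * (int p - 1)" using box by (intro mult_left_mono) auto
    also have "\<dots> = int p * int H - int H" by (simp add: algebra_simps)
    finally show ?thesis using box H mult_nonneg_nonneg[of "int H" "int (i + k)"]
      unfolding residue_def int_m by linarith
  next
    case tip
    then have "residue i j k = int p - int p * int H"
      using tip(1-3) unfolding residue_def by simp
    moreover have "0 \<le> int p * int H" by simp
    ultimately show ?thesis using tip H(3) unfolding int_m by linarith
  qed
  then show "int p + int d - int m \<le> residue i j k" "residue i j k < int p + int d" by auto
qed

text \<open>Since \<open>j + k < H\<close> unless \<open>i + k = 0\<close>, the residue determines
  \<open>i + k\<close> and then \<open>j + k\<close>. These two sums determine the monomial, because
  \<open>x\<close> and \<open>y\<close> do not both occur.\<close>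

lemma residue_inj:
  assumes s: "standard i j k" "standard i' j' k'" and r: "residue i j k = residue i' j' k'"
  shows "i = i' \<and> j = j' \<and> k = k'"
proof -
  have row: "j + k < H \<or> i + k = 0" if "standard i j k" for i j k
    using that H by (cases rule: standard_shape) auto
  have step: "\<not> i + k < i' + k'"
    if "standard i' j' k'" "residue i j k = residue i' j' k'" for i j k i' j' k'
  proof
    assume less: "i + k < i' + k'"
    then have "int H * 1 \<le> int H * (int (i' + k') - int (i + k))" by (intro mult_left_mono) auto
    also have "\<dots> = int (j' + k') - int (j + k)"
      using that(2) by (simp add: residue_def algebra_simps)
    finally have "H \<le> j' + k'" by simp
    then show False using row[OF that(1)] less by auto
  qed
  have u: "i + k = i' + k'" using step[OF s(2) r] step[OF s(1) r[symmetric]] by simp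
  then have "j + k = j' + k'" using r by (simp add: residue_def)
  then show ?thesis using u standardD(1)[OF s(1)] standardD(1)[OF s(2)] by auto
qed

lemma standard_inj:
  assumes s: "standard i j k" "standard i' j' k'" and eq: "n * m + val i j k = n' * m + val i' j' k'"
  shows "n = n' \<and> i = i' \<and> j = j' \<and> k = k'"
proof -
  have "int (n * m + val i j k) = int (n' * m + val i' j' k')" using eq by simp
  \<comment> \<open>The quotient is \<open>n' - n\<close> plus the difference of the coefficients of
    \<open>m\<close> in \<open>val_residue\<close>.\<close>
  then have "int m dvd residue i j k - residue i' j' k'"
    unfolding of_nat_add val_residue
    by (intro dvdI[of _ _ "int n' - int n +
         (int i' * (int d + 2) + int j' * int p + int k' * (int p + int d)) -
         (int i * (int d + 2) + int j * int p + int k * (int p + int d))"])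
       (simp add: algebra_simps)
  moreover have "\<bar>residue i j k - residue i' j' k'\<bar> < int m"
    using residue_window[OF s(1)] residue_window[OF s(2)] by linarith
  ultimately have "residue i j k = residue i' j' k'"
    using zdvd_imp_le[of "int m" "\<bar>residue i j k - residue i' j' k'\<bar>"] by fastforce
  then have "i = i' \<and> j = j' \<and> k = k'" using residue_inj s by blast
  then show ?thesis using eq m_pos by simp
qed

text \<open>A normal form of the other factorization must be the given standard monomial without
  \<open>w\<close>. Rewriting a nonstandard monomial would produce a positive power of
  \<open>w\<close>, so nothing was rewritten.\<close>

lemma standard_unique:
  assumes "standard i j k" "val i j k = n * m + val i' j' k'"
  shows "n = 0 \<and> i' = i \<and> j' = j \<and> k' = k"
proof -
  obtain l x y z where nf: "n \<le> l" "standard x y z" "n * m + val i' j' k' = l * m + val x y z"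
    using normal_form by blast
  then have "l = 0" using standard_inj[of i j k x y z 0 l] assms by simp
  then have "n = 0" using nf by simp
  have "standard i' j' k'"
  proof (rule ccontr)
    assume "\<not> standard i' j' k'"
    then obtain t x y z where t: "0 < t" "val i' j' k' = t * m + val x y z"
      using nonstandard_reducible by blast
    moreover obtain l x' y' z' where "t \<le> l" "standard x' y' z'"
        "t * m + val x y z = l * m + val x' y' z'"
      using normal_form by blast
    ultimately show False
      using standard_inj[of i j k x' y' z' 0 l] assms \<open>n = 0\<close> by simp
  qed
  then show ?thesis using standard_inj[of i j k i' j' k' 0 0] assms \<open>n = 0\<close> by auto
qed

section \<open>Corners and the values of their monomials\<close>

lemma standardI:
  assumes "i = 0 \<or> j = 0" "j < p + d" "\<And>v. v < p \<Longrightarrow> v \<le> k \<Longrightarrow> i + v < p"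
    "\<And>u. 1 \<le> u \<Longrightarrow> u \<le> H \<Longrightarrow> u \<le> k \<Longrightarrow> j + u < H"
  shows "standard i j k"
  unfolding standard_def
proof (intro ballI, clarify)
  fix x y z assume "(x, y, z) \<in> corners" and le: "x \<le> i" "y \<le> j" "z \<le> k"
  then show False
  proof (cases rule: corners_cases)
    case (xz v)
    then show False using assms(3)[of v] le by simp
  next
    case (yz u)
    then show False using assms(4)[of u] le by simp
  qed (use assms(1,2) le in auto)
qed

text \<open>No corner divides another. Here \<open>H \<le> p + d\<close> keeps the
  \<open>y\<close>-exponents \<open>H - u\<close> of the corners below \<open>p + d\<close>.\<close>

lemma standard_divisor:
  assumes "(i, j, k) \<in> corners" "i' \<le> i" "j' \<le> j" "k' \<le> k" "(i', j', k') \<noteq> (i, j, k)"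
  shows "standard i' j' k'"
  using assms(1)
proof (cases rule: corners_cases)
  case (xz v)
  with assms show ?thesis using p H by (intro standardI) auto
next
  case (yz u)
  with assms show ?thesis using p H by (intro standardI) auto
qed (use assms p H in \<open>auto intro!: standardI\<close>)

text \<open>Two right-hand sides are themselves corners and must be rewritten once more:
  \<open>x^p\<close>, reached from \<open>z^H\<close> if \<open>H = p + 1\<close>, and
  \<open>z^p\<close>, reached from \<open>y^(p+d)\<close> if \<open>H = p\<close>.\<close>

lemma corner_normal_form:
  assumes "(i, j, k) \<in> corners"
  obtains (xy) "i = 1" "j = 1" "k = 0" "val i j k = 2 * m + val 0 0 1" "standard 0 0 1"
    | (xz) v where "v < p" "i = p - v" "j = 0" "k = v"
        "val i j k = (2 * (p - v) - 1) * m + val 0 (d + v) 0" "standard 0 (d + v) 0"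
    | (yz) u where "1 \<le> u" "u \<le> p" "i = 0" "j = H - u" "k = u"
        "val i j k = (H * p + d + 2 - 2 * u) * m + val (u - 1) 0 0" "standard (u - 1) 0 0"
    | (z) "H = p + 1" "i = 0" "j = 0" "k = H"
        "val i j k = (H * p + d + 2 - 2 * H + (2 * p - 1)) * m + val 0 d 0" "standard 0 d 0"
    | (y_box) "H = p" "i = 0" "j = p + d" "k = 0"
        "val i j k = (H * p + d + 3 - 2 * p) * m + val (p - 1) 0 0" "standard (p - 1) 0 0"
    | (y_tip) "H = p + 1" "i = 0" "j = p + d" "k = 0" "val i j k = 1 * m + val 0 0 p" "standard 0 0 p"
  using assms
proof (cases rule: corners_cases)
  case xy
  moreover have "standard 0 0 1" using p H by (intro standardI) auto
  ultimately show ?thesis using that(1) relation_xy by (simp add: val_def)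
next
  case y
  have y: "val i j k = m + val 0 0 p" using y relation_y by (simp add: val_def)
  show ?thesis
  proof (cases "H = p")
    case True
    have "val 0 0 p = (H * p + d + 2 - 2 * p) * m + val (p - 1) 0 0"
      unfolding val_def using relation_yz'[of p] p True by simp
    moreover have "H * p + d + 3 - 2 * p = 1 + (H * p + d + 2 - 2 * p)"
      using yz_weight[of p] p True by simp
    ultimately have "val i j k = (H * p + d + 3 - 2 * p) * m + val (p - 1) 0 0"
      using y by (simp add: algebra_simps)
    moreover have "standard (p - 1) 0 0" using p H by (intro standardI) auto
    ultimately show ?thesis using that(5) True \<open>i = 0\<close> \<open>j = p + d\<close> \<open>k = 0\<close> by blast
  next
    case False
    then have "H = p + 1" using H by simp
    then have "standard 0 0 p" using p by (intro standardI) auto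
    then show ?thesis using that(6) y \<open>H = p + 1\<close> \<open>i = 0\<close> \<open>j = p + d\<close> \<open>k = 0\<close> by simp
  qed
next
  case (xz v)
  moreover have "standard 0 (d + v) 0" using xz p H by (intro standardI) auto
  ultimately show ?thesis using that(2)[of v] relation_xz[of v] by (simp add: val_def)
next
  case (yz u)
  have yz': "val i j k = (H * p + d + 2 - 2 * u) * m + val (u - 1) 0 0"
    using relation_yz'[of u] yz by (simp add: val_def)
  show ?thesis
  proof (cases "u \<le> p")
    case True
    then have "standard (u - 1) 0 0" using yz p H by (intro standardI) auto
    then show ?thesis using that(3)[of u] True yz yz' by blast
  next
    case False
    then have u: "u = H" "H = p + 1" using yz H by auto
    have "val p 0 0 = (2 * p - 1) * m + val 0 d 0"
      using relation_xz[of 0] p by (simp add: val_def)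
    then have "val i j k = (H * p + d + 2 - 2 * H + (2 * p - 1)) * m + val 0 d 0"
      using yz' u by (simp add: algebra_simps)
    moreover have "standard 0 d 0" using p H by (intro standardI) auto
    ultimately show ?thesis using that(4) u yz by simp
  qed
qed

text \<open>By \<open>standard_inj\<close>, equal values force equal normal forms. Wherever the
  monomials of two distinct corners reduce to the same standard monomial, the powers of
  \<open>w\<close> differ.\<close>

lemma corner_val_inj:
  assumes g: "(i, j, k) \<in> corners" and g': "(i', j', k') \<in> corners"
    and eq: "val i j k = val i' j' k'"
  shows "(i, j, k) = (i', j', k')"
proof -
  have inj: "n = n' \<and> x = x' \<and> y = y' \<and> z = z'"
    if "val i j k = n * m + val x y z" "standard x y z"
      "val i' j' k' = n' * m + val x' y' z'" "standard x' y' z'" for n x y z n' x' y' z'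
    using standard_inj that eq by metis
  have q: "2 * H \<le> H * p" using p by simp
  show ?thesis
    using g
  proof (cases rule: corner_normal_form)
    case xy
    note nf = xy
    from g' show ?thesis
    proof (cases rule: corner_normal_form)
      case (yz w)
      with inj[OF nf(4,5) yz(6,7)] nf show ?thesis by auto
    next
      case (xz w)
      with inj[OF nf(4,5) xz(5,6)] nf show ?thesis by auto
    next
      case z
      with inj[OF nf(4,5) z(5,6)] nf show ?thesis by auto
    next
      case y_box
      with inj[OF nf(4,5) y_box(5,6)] nf show ?thesis by auto
    next
      case y_tip
      with inj[OF nf(4,5) y_tip(5,6)] nf p show ?thesis by auto
    qed (use nf in auto)
  next
    case (xz v)
    note nf = xz
    from g' show ?thesis
    proof (cases rule: corner_normal_form)
      case (yz u)
      \<comment> \<open>Both monomials reduce to a pure power of \<open>w\<close>, with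
        \<open>u = 1\<close>; but \<open>H * p + d \<ge> 2 * H\<close> exceeds
        \<open>2 * (p - v) - 1\<close>.\<close>
      from inj[OF nf(5,6) yz(6,7)] yz(1) have "2 * (p - v) - 1 = H * p + d" by auto
      then show ?thesis using q p H by linarith
    next
      case z
      with inj[OF nf(5,6) z(5,6)] nf q p H show ?thesis by auto
    next
      case (xz w)
      with inj[OF nf(5,6) xz(5,6)] nf show ?thesis by auto
    next
      case xy
      with inj[OF nf(5,6) xy(4,5)] nf show ?thesis by auto
    next
      case y_box
      with inj[OF nf(5,6) y_box(5,6)] nf p show ?thesis by auto
    next
      case y_tip
      with inj[OF nf(5,6) y_tip(5,6)] nf p show ?thesis by auto
    qed
  next
    case (yz u)
    note nf = yz
    from g' show ?thesis
    proof (cases rule: corner_normal_form)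
      case (yz w)
      from inj[OF nf(6,7) yz(6,7)] nf(1) yz(1) have "u = w" by linarith
      then show ?thesis using nf yz by simp
    next
      case z
      with inj[OF nf(6,7) z(5,6)] nf q p H show ?thesis by auto
    next
      case (xz w)
      from inj[OF nf(6,7) xz(5,6)] nf(1) have "2 * (p - w) - 1 = H * p + d" by auto
      then show ?thesis using q p H by linarith
    next
      case xy
      with inj[OF nf(6,7) xy(4,5)] nf show ?thesis by auto
    next
      case y_box
      \<comment> \<open>Both reduce to \<open>x^(p-1)\<close> with \<open>u = p\<close>, but the
        exponents of \<open>w\<close> differ by one.\<close>
      from inj[OF nf(6,7) y_box(5,6)] nf(1,2) yz_weight[of u] H(1) show ?thesis by linarith
    next
      case y_tip
      with inj[OF nf(6,7) y_tip(5,6)] nf p show ?thesis by auto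
    qed
  next
    case z
    note nf = z
    from g' show ?thesis
    proof (cases rule: corner_normal_form)
      case (yz w)
      with inj[OF nf(5,6) yz(6,7)] nf q p H show ?thesis by auto
    next
      case (xz w)
      with inj[OF nf(5,6) xz(5,6)] nf q p H show ?thesis by auto
    next
      case xy
      with inj[OF nf(5,6) xy(4,5)] nf show ?thesis by auto
    next
      case y_box
      with nf show ?thesis by auto
    next
      case y_tip
      with inj[OF nf(5,6) y_tip(5,6)] nf p show ?thesis by auto
    qed (use nf in auto)
  next
    case y_box
    note nf = y_box
    from g' show ?thesis
    proof (cases rule: corner_normal_form)
      case (yz w)
      from inj[OF nf(5,6) yz(6,7)] yz(1,2) yz_weight[of w] H(1) show ?thesis by linarith
    next
      case (xz w)
      with inj[OF nf(5,6) xz(5,6)] nf q p H show ?thesis by auto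
    next
      case xy
      with inj[OF nf(5,6) xy(4,5)] nf show ?thesis by auto
    qed (use nf in auto)
  next
    case y_tip
    note nf = y_tip
    from g' show ?thesis
    proof (cases rule: corner_normal_form)
      case (yz w)
      with inj[OF nf(5,6) yz(6,7)] nf q p H show ?thesis by auto
    next
      case (xz w)
      with inj[OF nf(5,6) xz(5,6)] nf q p H show ?thesis by auto
    next
      case xy
      with inj[OF nf(5,6) xy(4,5)] nf p show ?thesis by auto
    next
      case z
      with inj[OF nf(5,6) z(5,6)] nf p show ?thesis by auto
    qed (use nf in auto)
  qed
qed

lemma card_corners: "finite corners" "card corners = p + H + 2"
proof -
  let ?A = "(\<lambda>v. (p - v, 0 :: nat, v)) ` {..<p}" and ?B = "(\<lambda>u. (0 :: nat, H - u, u)) ` {1..H}"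
  have "card ?A = p" "card ?B = H"
    by (simp_all add: card_image inj_on_def)
  moreover have "?A \<inter> ?B = {}" by auto
  ultimately have AB: "card (?A \<union> ?B) = p + H" by (simp add: card_Un_disjoint)
  have "(1, 1, 0) \<notin> insert (0, p + d, 0) (?A \<union> ?B)" "(0, p + d, 0) \<notin> ?A \<union> ?B"
    using p by auto
  moreover have "corners = insert (1, 1, 0) (insert (0, p + d, 0) (?A \<union> ?B))"
    unfolding corners_def by auto
  ultimately show "card corners = p + H + 2" "finite corners" using AB by simp_all
qed

subsection \<open>The semigroup and its generators\<close>

definition S :: "nat set" where
  "S = {n * m + val i j k | n i j k. True}"

lemma val_add: "val i j k + val i' j' k' = val (i + i') (j + j') (k + k')"
  by (simp add: val_def algebra_simps)

lemma val_unit: "val 1 0 0 = a" "val 0 1 0 = b" "val 0 0 1 = c" "val 0 0 0 = 0"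
  by (simp_all add: val_def)

lemma standard_unit: "standard 1 0 0" "standard 0 1 0" "standard 0 0 1"
  using p H by (auto intro!: standardI)

lemma distinct_generators: "distinct [m, a, b, c]"
proof -
  have "a \<noteq> b" "a \<noteq> c"
    using standard_unique[OF standard_unit(1), of 0 0 1 0]
      standard_unique[OF standard_unit(1), of 0 0 0 1] by (auto simp: val_def)
  moreover have "b \<noteq> c"
    using standard_unique[OF standard_unit(2), of 0 0 0 1] by (auto simp: val_def)
  ultimately show ?thesis using m_less by auto
qed

lemma mem_S_ge:
  assumes "s \<in> S" "s \<noteq> 0" shows "m \<le> s"
proof -
  obtain n i j k where s: "s = n * m + (i * a + j * b + k * c)"
    using assms(1) unfolding S_def val_def by blast
  with assms(2) have "n \<noteq> 0 \<or> i \<noteq> 0 \<or> j \<noteq> 0 \<or> k \<noteq> 0" by auto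
  then have "m \<le> n * m \<or> a \<le> i * a \<or> b \<le> j * b \<or> c \<le> k * c" by auto
  then show ?thesis using m_less unfolding s by linarith
qed

lemma submonoid_S: "submonoid S"
proof -
  have memI: "s \<in> S" if "s = n * m + val i j k" for s n i j k
    using that unfolding S_def by blast
  show ?thesis
    unfolding submonoid_def
  proof (intro conjI ballI)
    show "0 \<in> S" by (rule memI[of _ 0 0 0 0]) (simp add: val_unit)
    fix s t assume "s \<in> S" "t \<in> S"
    then obtain n i j k n' i' j' k' where "s = n * m + val i j k" "t = n' * m + val i' j' k'"
      unfolding S_def by blast
    then show "s + t \<in> S"
      by (intro memI[of _ "n + n'" "i + i'" "j + j'" "k + k'"]) (simp add: add_mult_distrib flip: val_add)
  qed
qed

lemma hull_generators: "submonoid hull {m, a, b, c} = S"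
proof
  have "m = 1 * m + val 0 0 0" "a = 0 * m + val 1 0 0" "b = 0 * m + val 0 1 0" "c = 0 * m + val 0 0 1"
    by (simp_all add: val_def)
  then have "{m, a, b, c} \<subseteq> S" unfolding S_def by blast
  then show "submonoid hull {m, a, b, c} \<subseteq> S"
    using hull_minimal[of "{m, a, b, c}" S submonoid] submonoid_S by simp
  have gens: "{m, a, b, c} \<subseteq> submonoid hull {m, a, b, c}" by (rule hull_subset)
  show "S \<subseteq> submonoid hull {m, a, b, c}"
  proof
    fix s assume "s \<in> S"
    then obtain n i j k where s: "s = n * m + (i * a + j * b + k * c)"
      unfolding S_def val_def by blast
    have add: "x + y \<in> submonoid hull {m, a, b, c}"
      if "x \<in> submonoid hull {m, a, b, c}" "y \<in> submonoid hull {m, a, b, c}" for x y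
      using submonoid_hull[of "{m, a, b, c}"] that unfolding submonoid_def by blast
    show "s \<in> submonoid hull {m, a, b, c}"
      unfolding s using gens by (intro add submonoid_mult[OF submonoid_hull]) auto
  qed
qed

text \<open>A single variable that is standard is the only factorization of its value, so one of the
  two summands has the empty factorization.\<close>

lemma standard_irreducible:
  assumes "standard i j k" "i + j + k = 1" "s \<in> S" "t \<in> S" "val i j k = s + t"
  shows "s = 0 \<or> t = 0"
proof -
  obtain n x y z n' x' y' z' where st: "s = n * m + val x y z" "t = n' * m + val x' y' z'"
    using assms(3,4) unfolding S_def by blast
  have "val i j k = (n + n') * m + val (x + x') (y + y') (z + z')"
    using assms(5) st by (simp add: add_mult_distrib flip: val_add)
  then have "n + n' = 0 \<and> x + x' = i \<and> y + y' = j \<and> z + z' = k"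
    using standard_unique[OF assms(1)] by blast
  then have "n = 0" "n' = 0" "x = 0 \<and> y = 0 \<and> z = 0 \<or> x' = 0 \<and> y' = 0 \<and> z' = 0"
    using assms(2) by auto
  then show ?thesis using st by (auto simp: val_unit)
qed

lemma minimal_generators_S: "minimal_generators S = {m, a, b, c}"
proof (rule minimal_generators_eq[OF hull_generators])
  show "g \<noteq> 0" if "g \<in> {m, a, b, c}" for g using that m_pos m_less by auto
  fix g s t assume "g \<in> {m, a, b, c}" and st: "s \<in> S" "t \<in> S" "g = s + t"
  then consider "g = m" | "g = val 1 0 0" | "g = val 0 1 0" | "g = val 0 0 1"
    unfolding val_unit by blast
  then show "s = 0 \<or> t = 0"
  proof cases
    case 1
    then show ?thesis using mem_S_ge[OF st(1)] mem_S_ge[OF st(2)] st(3) m_pos by linarith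
  next
    case 2
    then show ?thesis using standard_irreducible[OF standard_unit(1) _ st(1,2)] st(3) by simp
  next
    case 3
    then show ?thesis using standard_irreducible[OF standard_unit(2) _ st(1,2)] st(3) by simp
  next
    case 4
    then show ?thesis using standard_irreducible[OF standard_unit(3) _ st(1,2)] st(3) by simp
  qed
qed

lemma numerical_semigroup_S: "numerical_semigroup S"
proof -
  \<comment> \<open>Since \<open>b\<close> is 1 modulo \<open>m\<close>, taking
    \<open>n mod m\<close> copies of \<open>b\<close> gives the residue of \<open>n\<close>; the
    remainder is a nonnegative multiple of \<open>m\<close>.\<close>
  have "n \<in> S" if "m * b \<le> n" for n
  proof -
    have "n mod m < m" using m_pos by simp
    then have le: "(n mod m) * b \<le> n"
      using that by (meson dual_order.trans less_imp_le mult_le_mono1)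
    have "((n mod m) * b) mod m = ((n mod m) * (b mod m)) mod m" by (simp add: mod_mult_right_eq)
    also have "b mod m = 1 mod m" by (simp only: b_def mod_mult_self4)
    finally have "((n mod m) * b) mod m = n mod m" by simp
    then have "m dvd n - (n mod m) * b" using le by (metis mod_eq_dvd_iff_nat)
    then obtain q where "n - (n mod m) * b = m * q" by (rule dvdE)
    then have "n = q * m + val 0 (n mod m) 0" using le by (simp add: val_def mult.commute)
    then show ?thesis unfolding S_def by blast
  qed
  then have "- S \<subseteq> {..<m * b}" by (meson ComplD lessThan_iff not_le subsetI)
  then show ?thesis using submonoid_S finite_subset by (auto simp: numerical_semigroup_def)
qed

lemma embedding_dimension_S: "embedding_dimension S = 4"
  using distinct_generators by (simp add: embedding_dimension_def minimal_generators_S)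

lemma Min_generators: "Min {m, a, b, c} = m"
  using m_less by (intro Min_eqI) auto

lemma multiplicity_S: "multiplicity S = m"
  by (simp only: multiplicity_def minimal_generators_S Min_generators)

lemma generator_indices:
  obtains x y z where "{..<4} = {0, x, y, z}" "distinct [0, x, y, z]"
    "generator S 0 = m" "generator S x = a" "generator S y = b" "generator S z = c"
proof -
  define L where "L = sorted_list_of_set {m, a, b, c}"
  have gen: "generator S i = L ! i" for i by (simp add: generator_def minimal_generators_S L_def)
  have L: "set L = {m, a, b, c}" "length L = 4"
    using distinct_generators unfolding L_def
    by (simp_all only: set_sorted_list_of_set length_sorted_list_of_set finite.intros) simp
  have "L ! 0 = m"
    using sorted_list_of_set_nonempty[of "{m, a, b, c}"] unfolding L_def Min_generators by simp
  moreover obtain x where x: "x < 4" "L ! x = a" using L by (metis in_set_conv_nth insertCI)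
  moreover obtain y where y: "y < 4" "L ! y = b" using L by (metis in_set_conv_nth insertCI)
  moreover obtain z where z: "z < 4" "L ! z = c" using L by (metis in_set_conv_nth insertCI)
  moreover have distinct: "distinct [0, x, y, z]"
  proof (rule distinct_map[THEN iffD1, THEN conjunct1])
    show "distinct (map ((!) L) [0, x, y, z])"
      using distinct_generators \<open>L ! 0 = m\<close> x(2) y(2) z(2) by simp
  qed
  moreover have "{..<4} = {0, x, y, z}"
  proof (rule card_subset_eq[symmetric])
    show "{0, x, y, z} \<subseteq> {..<4}" using x y z by auto
    show "card {0, x, y, z} = card {..<4 :: nat}" using distinct by simp
  qed simp
  ultimately show ?thesis using that[of x y z] by (simp only: gen)
qed

end

text \<open>The position of \<open>a\<close>, \<open>b\<close> and \<open>c\<close> in the increasing order of the generators depends on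
  the parameters, so their indices are kept abstract.\<close>

locale indexed_staircase = staircase +
  fixes x y z :: nat
  assumes indices: "{..<4} = {0, x, y, z}" "distinct [0, x, y, z]"
    and generators: "generator S 0 = m" "generator S x = a" "generator S y = b" "generator S z = c"
begin

definition monomial :: "nat \<Rightarrow> nat \<Rightarrow> nat \<Rightarrow> nat \<Rightarrow> nat \<Rightarrow> nat" where
  "monomial n i j k = (\<lambda>l. if l = 0 then n else if l = x then i else if l = y then j
     else if l = z then k else 0)"

lemma less_4_iff: "l < 4 \<longleftrightarrow> l = 0 \<or> l = x \<or> l = y \<or> l = z"
  unfolding lessThan_iff[symmetric] indices(1) by simp

lemma monomial_simps [simp]:
  "monomial n i j k 0 = n" "monomial n i j k x = i" "monomial n i j k y = j" "monomial n i j k z = k"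
  "monomial n i j k \<in> tuples 4"
proof -
  have "monomial n i j k l = 0" if "4 \<le> l" for l
    using that less_4_iff[of l] by (simp add: monomial_def)
  then show "monomial n i j k \<in> tuples 4" by (simp add: tuples_def)
qed (use indices(2) in \<open>auto simp: monomial_def\<close>)

lemma tuple_eqI:
  assumes "u \<in> tuples 4" "w \<in> tuples 4" "u 0 = w 0" "u x = w x" "u y = w y" "u z = w z"
  shows "u = w"
proof
  fix l show "u l = w l"
    using assms less_4_iff[of l] by (cases "l < 4") (auto simp: tuples_def)
qed

lemma factorization_map_S:
  "factorization_map S u = u 0 * m + val (u x) (u y) (u z)"
  using indices(2)
  by (simp add: factorization_map_def embedding_dimension_S indices(1) generators val_def)

lemma kernel_S:
  "(u, w) \<in> factorization_kernel S \<longleftrightarrow> u \<in> tuples 4 \<and> w \<in> tuples 4 \<and>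
    u 0 * m + val (u x) (u y) (u z) = w 0 * m + val (w x) (w y) (w z)"
  by (simp add: factorization_kernel_def embedding_dimension_S factorization_map_S)

lemma standard_uniquely_factored:
  assumes "u 0 = 0" "standard (u x) (u y) (u z)"
  shows "uniquely_factored S u"
  unfolding uniquely_factored_def
proof (intro allI impI)
  fix w assume "(u, w) \<in> factorization_kernel S"
  then have w: "u \<in> tuples 4" "w \<in> tuples 4" "val (u x) (u y) (u z) = w 0 * m + val (w x) (w y) (w z)"
    using assms(1) by (auto simp: kernel_S)
  then show "w = u"
    using standard_unique[OF assms(2) w(3)] assms(1) by (intro tuple_eqI) auto
qed

text \<open>Atom 0 is the variable \<open>w\<close> of value \<open>m\<close>: the corners do not
  contain it, whereas the right-hand sides of their relations do.\<close>

sublocale isolated_factorizations S "(\<lambda>(i, j, k). monomial 0 i j k) ` corners"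
proof
  show "0 < embedding_dimension S" by (simp add: embedding_dimension_S)
  show "0 < generator S i" if "i < embedding_dimension S" for i
    using that less_4_iff[of i] generators m_pos m_less by (auto simp: embedding_dimension_S)
  show "finite ((\<lambda>(i, j, k). monomial 0 i j k) ` corners)" using card_corners(1) by simp
  show "(\<lambda>(i, j, k). monomial 0 i j k) ` corners \<subseteq> tuples (embedding_dimension S)"
    by (auto simp: embedding_dimension_S)
  show "inj_on (factorization_map S) ((\<lambda>(i, j, k). monomial 0 i j k) ` corners)"
  proof (rule inj_onI)
    fix g g' assume "g \<in> (\<lambda>(i, j, k). monomial 0 i j k) ` corners"
      "g' \<in> (\<lambda>(i, j, k). monomial 0 i j k) ` corners"
      and eq: "factorization_map S g = factorization_map S g'"
    then obtain i j k i' j' k' where g: "(i, j, k) \<in> corners" "g = monomial 0 i j k"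
      and g': "(i', j', k') \<in> corners" "g' = monomial 0 i' j' k'"
      by auto
    have "val i j k = val i' j' k'" using eq g g' by (simp add: factorization_map_S)
    then show "g = g'" using corner_val_inj g g' by blast
  qed
  fix g assume "g \<in> (\<lambda>(i, j, k). monomial 0 i j k) ` corners"
  then obtain i j k where g: "(i, j, k) \<in> corners" "g = monomial 0 i j k" by auto
  show "g 0 = 0" using g by simp
  obtain n i' j' k' where n: "0 < n" "val i j k = n * m + val i' j' k'"
    using corner_reducible[OF g(1)] by blast
  then have "(g, monomial n i' j' k') \<in> factorization_kernel S" by (simp add: kernel_S g)
  then show "\<exists>r. (g, r) \<in> factorization_kernel S \<and> 0 < r 0"
    using n by (intro exI[of _ "monomial n i' j' k'"]) simp
next
  fix u w assume u: "u \<in> tuples (embedding_dimension S)" "w \<in> tuples (embedding_dimension S)"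
    "(\<lambda>i. u i + w i) \<in> (\<lambda>(i, j, k). monomial 0 i j k) ` corners" "w \<noteq> (\<lambda>i. 0)"
  then obtain i j k where g: "(i, j, k) \<in> corners" "(\<lambda>l. u l + w l) = monomial 0 i j k" by auto
  have eq: "u 0 + w 0 = 0" "u x + w x = i" "u y + w y = j" "u z + w z = k"
    using fun_cong[OF g(2)] by simp_all
  have "(u x, u y, u z) \<noteq> (i, j, k)"
  proof
    assume "(u x, u y, u z) = (i, j, k)"
    then have "w = monomial 0 0 0 0"
      using u eq by (intro tuple_eqI) (auto simp: embedding_dimension_S)
    then show False using u(4) by (auto simp: monomial_def)
  qed
  then have "standard (u x) (u y) (u z)" using eq by (intro standard_divisor[OF g(1)]) auto
  then show "uniquely_factored S u" using eq by (intro standard_uniquely_factored) auto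
next
  fix u assume u: "u \<in> tuples (embedding_dimension S)" "u 0 = 0" "\<not> uniquely_factored S u"
  then have "\<not> standard (u x) (u y) (u z)" using standard_uniquely_factored by blast
  then obtain i j k where c: "(i, j, k) \<in> corners" "i \<le> u x" "j \<le> u y" "k \<le> u z"
    by (auto simp: standard_def)
  define w where "w = monomial 0 (u x - i) (u y - j) (u z - k)"
  have "w \<in> tuples (embedding_dimension S)" by (simp add: w_def embedding_dimension_S)
  moreover have "u = (\<lambda>l. monomial 0 i j k l + w l)"
    using u c by (intro tuple_eqI) (auto simp: w_def embedding_dimension_S add_in_tuples)
  ultimately show "\<exists>g\<in>(\<lambda>(i, j, k). monomial 0 i j k) ` corners.
      \<exists>w\<in>tuples (embedding_dimension S). u = (\<lambda>i. g i + w i)"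
    using c(1) by (intro bexI[of _ "monomial 0 i j k"] bexI[of _ w]) force+
qed

lemma eta_indexed: "eta S = p + H + 2"
proof -
  have "inj_on (\<lambda>(i, j, k). monomial 0 i j k) corners"
  proof (rule inj_onI)
    fix g g' assume "(\<lambda>(i, j, k). monomial 0 i j k) g = (\<lambda>(i, j, k). monomial 0 i j k) g'"
    from fun_cong[OF this, of x] fun_cong[OF this, of y] fun_cong[OF this, of z]
    show "g = g'" by (simp add: case_prod_beta prod_eq_iff)
  qed
  then show ?thesis using eta_eq_card card_corners(2) by (simp add: card_image)
qed

end

lemma (in staircase) eta_S: "eta S = p + H + 2"
proof -
  obtain x y z where "{..<4} = {0, x, y, z}" "distinct [0, x, y, z]"
    "generator S 0 = m" "generator S x = a" "generator S y = b" "generator S z = c"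
    using generator_indices .
  then interpret indexed_staircase p H d x y z by unfold_locales
  show ?thesis by (rule eta_indexed)
qed

section \<open>Choice of the parameters\<close>

theorem theorem6p3:
  fixes \<eta> m :: nat
  assumes "\<eta> \<ge> 6" and "m > 0" and "4 * m \<ge> (\<eta> - 2)\<^sup>2"
  shows "\<exists>S. numerical_semigroup S \<and> embedding_dimension S = 4 \<and> multiplicity S = m \<and> eta S = \<eta>"
proof -
  \<comment> \<open>The most even splitting \<open>\<eta> - 2 = p + H\<close> makes
    \<open>p * H\<close> the integer part of a quarter of the square of
    \<open>\<eta> - 2\<close>.\<close>
  define p where "p = (\<eta> - 2) div 2"
  define H where "H = \<eta> - 2 - p"
  define d where "d = m - p * H"
  have pH: "2 \<le> p" "p \<le> H" "H \<le> p + 1" "p + H + 2 = \<eta>"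
    using assms(1) unfolding p_def H_def by auto
  then have "(\<eta> - 2)\<^sup>2 = (p + H)\<^sup>2" by auto
  then have "(p + H)\<^sup>2 \<le> 4 * m" using assms(3) by simp
  moreover have "(p + H)\<^sup>2 = 4 * (p * H) + (H - p)"
  proof (cases "H = p")
    case False
    then have "H = p + 1" using pH by simp
    then show ?thesis by (simp add: power2_eq_square algebra_simps)
  qed (simp add: power2_eq_square algebra_simps)
  \<comment> \<open>If \<open>H = p + 1\<close>, the bound reads
    \<open>4 * (p * H) + 1 \<le> 4 * m\<close>, so \<open>d \<ge> 1\<close> by integrality, which
    gives \<open>H \<le> p + d\<close>.\<close>
  ultimately have "p * H \<le> m" "H \<le> p + d" using pH unfolding d_def by auto
  then interpret staircase p H d using pH by unfold_locales
  have "staircase.m p H d = m" using \<open>p * H \<le> m\<close> by (simp only: m_def) (simp add: d_def)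
  then show ?thesis
    using numerical_semigroup_S embedding_dimension_S multiplicity_S eta_S pH(4) by metis
qed

end
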